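(* Let $1\le d\le n$ be integers, $\sigma>0$, $\mu\in\mathbb{R}^d$, $\Sigma\in\mathrm{SPD}(d)$, $U\in\mathrm{St}(d,n)$ and $b\in\mathbb{R}^n$. Let $f$ denote the Gaussian density function (in dimension $d$ or $n$, according to its arguments). Then for all $x\in\mathbb{R}^n$, $$ f\big(U^{\mathrm T}(x-b)\,\big|\,\mu,\Sigma\big)\,\exp\Big(-\tfrac{1}{2\sigma^2}\|(I_n-UU^{\mathrm T})(x-b)\|^2\Big)=(2\pi\sigma^2)^{\frac{n-d}{2}}\,f(x\,|\,\tilde\mu,\tilde\Sigma), $$ where $$ \tilde\Sigma=\Big(\tfrac1{\sigma^2}(I_n-UU^{\mathrm T})+U\Sigma^{-1}U^{\mathrm T}\Big)^{-1}\in\mathrm{SPD}(n),\qquad \tilde\mu=\tilde\Sigma\,U\,\Sigma^{-1}\mu+b\in\mathbb{R}^n $$ (in particular, the inverse defining $\tilde\Sigma$ exists).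
   Context: $\mathrm{SPD}(m)$ is the set of real symmetric positive definite $m\times m$ matrices. $\mathrm{St}(d,n)=\{U\in\mathbb{R}^{n\times d}: U^{\mathrm T}U=I_d\}$, $n\ge d$, is the Stiefel manifold. For $m\in\mathbb{N}$, $\nu\in\mathbb{R}^m$ and $\Lambda\in\mathrm{SPD}(m)$, the Gaussian density is $f(z|\nu,\Lambda)=(2\pi)^{-m/2}|\Lambda|^{-1/2}\exp\big(-\tfrac12(z-\nu)^{\mathrm T}\Lambda^{-1}(z-\nu)\big)$, $z\in\mathbb{R}^m$, where $|\Lambda|$ is the determinant. $\|\cdot\|$ is the Euclidean norm. *)

theory Defs
  imports "HOL-Analysis.Analysis"
begin

definition SPD :: "(real ^ 'm ^ 'm) set" where
  "SPD = {A. transpose A = A \<and> (\<forall>z. z \<noteq> 0 \<longrightarrow> z \<bullet> (A *v z) > 0)}"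

text \<open>
  The type \<open>real ^ 'd ^ 'n\<close> consists of the matrices with rows indexed by \<open>'n\<close> and columns
  indexed by \<open>'d\<close>.
\<close>

definition Stiefel :: "(real ^ 'd ^ 'n) set" where
  "Stiefel = {U. transpose U ** U = mat 1}"

text \<open>
  \<open>gaussian_density z \<nu> \<Lambda>\<close> is written $f(z | \nu, \Lambda)$ in the literature.  It is meant for
  \<open>\<Lambda> \<in> SPD\<close>, where \<open>det \<Lambda> > 0\<close> and \<open>matrix_inv \<Lambda>\<close> is the genuine inverse.
\<close>

definition gaussian_density :: "real ^ 'm \<Rightarrow> real ^ 'm \<Rightarrow> real ^ 'm ^ 'm \<Rightarrow> real" where
  "gaussian_density z \<nu> \<Lambda> =
     (2 * pi) powr (- real CARD('m) / 2) * det \<Lambda> powr (- 1 / 2) *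
     exp (- (1 / 2) * ((z - \<nu>) \<bullet> (matrix_inv \<Lambda> *v (z - \<nu>))))"

end

theory Submission
  imports Defs
begin

text \<open>
  Write \<open>z = x - b - U \<mu>\<close>.  Since \<open>U\<^sup>T U = I\<close>, we have \<open>P U = U \<Sigma>\<^sup>-\<^sup>1\<close>, hence \<open>\<mu>' - b = U \<mu>\<close>, and the form
  \<open>z \<bullet> P z\<close> splits into \<open>\<sigma>\<^sup>-\<^sup>2\<close> times the squared norm of \<open>(I - U U\<^sup>T) z = (I - U U\<^sup>T) (x - b)\<close> and the
  form of \<open>\<Sigma>\<^sup>-\<^sup>1\<close> at \<open>U\<^sup>T z = U\<^sup>T (x - b) - \<mu>\<close>.  This shows that \<open>P\<close> is positive definite and matches the
  exponents.  The normalising constants agree because Sylvester's identity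
  \<open>det (I + X Y) = det (I + Y X)\<close>, applied to \<open>\<sigma>\<^sup>2 P = I + U (\<sigma>\<^sup>2 \<Sigma>\<^sup>-\<^sup>1 - I) U\<^sup>T\<close>, determines \<open>det P\<close>.
\<close>

section \<open>Determinants of block matrices and Sylvester's identity\<close>

text \<open>In the Leibniz sum, a permutation that moves an index outside \<open>range e\<close>
  meets a zero of a unit row. The surviving permutations come from those of \<open>'m\<close> by
  transport along \<open>e\<close>, which preserves the sign.\<close>

lemma det_unit_rows:
  fixes M :: "'a::comm_ring_1 ^ 'n ^ 'n" and e :: "'m::finite \<Rightarrow> 'n"
  assumes inj: "inj e" and unit: "\<And>i. i \<notin> range e \<Longrightarrow> M $ i = axis i 1"
  shows "det M = det (\<chi> i j. M $ e i $ e j)"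
proof -
  let ?t = "\<lambda>p. of_int (sign p) * (\<Prod>i\<in>UNIV. M $ i $ p i)"
  have bij: "bij_betw e UNIV (range e)"
    using inj by (simp add: bij_betw_def)
  have zero: "?t p = 0" if p: "p permutes UNIV" "\<not> p permutes range e" for p
  proof -
    obtain i where i: "i \<notin> range e" "p i \<noteq> i"
      using permutes_superset[OF p(1), of "range e"] p(2) by blast
    then have "M $ i $ p i = 0"
      by (simp add: unit axis_def)
    then have "(\<Prod>i\<in>UNIV. M $ i $ p i) = 0"
      by (intro prod_zero) auto
    then show ?thesis by simp
  qed
  have "det M = (\<Sum>p | p permutes range e. ?t p)"
    unfolding det_def
    by (rule sum.mono_neutral_right)
      (auto simp: finite_permutations permutes_subset[OF _ subset_UNIV] dest: zero)
  also have "\<dots> = (\<Sum>p | p permutes (UNIV :: 'm set).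
      of_int (sign p) * (\<Prod>i\<in>UNIV. M $ e i $ e (p i)))"
  \<comment> \<open>Transport along \<open>e\<close> extends a permutation by the identity outside
    \<open>range e\<close>; transport along \<open>inv e\<close> undoes it.\<close>
  proof (rule sum.reindex_bij_witness[of _ "map_permutation UNIV e"
        "map_permutation (range e) (inv e)"])
    fix p assume "p \<in> {p. p permutes range e}"
    then have p: "p permutes range e" by simp
    have bij': "bij_betw (inv e) (range e) UNIV"
      using inj by (simp add: bij_betw_def inj_on_inv_into inj_imp_surj_inv)
    let ?q = "map_permutation (range e) (inv e) p"
    show q: "?q \<in> {p. p permutes UNIV}"
      using map_permutation_permutes[OF bij' p] by simp
    show cancel: "map_permutation UNIV e ?q = p"
      by (rule map_permutation_compose_inv[OF bij' p]) (auto simp: f_inv_into_f)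
    have eq: "e (?q i) = p (e i)" for i
      using map_permutation_apply[OF inj, of i ?q] cancel by simp
    \<comment> \<open>An index outside \<open>range e\<close> is fixed by \<open>p\<close>, so its
      factor is the diagonal 1 of a unit row.\<close>
    have "(\<Prod>i\<in>UNIV. M $ i $ p i) = (\<Prod>i\<in>range e. M $ i $ p i)"
      using p by (intro prod.mono_neutral_right) (auto simp: unit permutes_not_in)
    also have "\<dots> = (\<Prod>i\<in>UNIV. M $ e i $ p (e i))"
      using inj by (simp add: prod.reindex)
    finally show "of_int (sign ?q) * (\<Prod>i\<in>UNIV. M $ e i $ e (?q i)) = ?t p"
      using bij' p by (simp add: eq sign_map_permutation bij_betw_def)
  next
    fix p assume "p \<in> {p. p permutes (UNIV :: 'm set)}"
    then have p: "p permutes (UNIV :: 'm set)" by simp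
    show "map_permutation UNIV e p \<in> {p. p permutes range e}"
      using map_permutation_permutes[OF bij p] by simp
    show "map_permutation (range e) (inv e) (map_permutation UNIV e p) = p"
      by (rule map_permutation_compose_inv[OF bij p]) (use inj in auto)
  qed
  also have "\<dots> = det (\<chi> i j. M $ e i $ e j)"
    by (simp add: det_def)
  finally show ?thesis .
qed

text \<open>Sum types as index types avoid offsets: \<open>Inl\<close> and \<open>Inr\<close> label
  the two block rows and block columns.\<close>

definition block_mat ::
  "'a ^ 'n ^ 'm \<Rightarrow> 'a ^ 'k ^ 'm \<Rightarrow> 'a ^ 'n ^ 'l \<Rightarrow> 'a ^ 'k ^ 'l \<Rightarrow> 'a ^ ('n + 'k) ^ ('m + 'l)"
where
  "block_mat A B C D = (\<chi> i j. case i of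
      Inl i \<Rightarrow> (case j of Inl j \<Rightarrow> A $ i $ j | Inr j \<Rightarrow> B $ i $ j)
    | Inr i \<Rightarrow> (case j of Inl j \<Rightarrow> C $ i $ j | Inr j \<Rightarrow> D $ i $ j))"

lemma block_mat_mult:
  fixes A :: "'a::semiring_1 ^ 'n::finite ^ 'm::finite" and B :: "'a ^ 'k::finite ^ 'm"
    and C :: "'a ^ 'n ^ 'l::finite"
  shows "block_mat A B C D ** block_mat A' B' C' D' =
    block_mat (A ** A' + B ** C') (A ** B' + B ** D') (C ** A' + D ** C') (C ** B' + D ** D')"
  by (auto simp: vec_eq_iff block_mat_def matrix_matrix_mult_def UNIV_Plus_UNIV[symmetric]
      sum.Plus simp del: UNIV_Plus_UNIV split: sum.splits)

lemma det_block_mat_upper: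
  fixes A :: "'a::comm_ring_1 ^ 'n::finite ^ 'n" and B :: "'a ^ 'k::finite ^ 'n"
  shows "det (block_mat A B 0 (mat 1)) = det A"
proof -
  have "block_mat A B 0 (mat 1) $ i = axis i 1" if "i \<notin> range Inl" for i
    using that by (cases i) (auto simp: block_mat_def vec_eq_iff axis_def mat_def split: sum.splits)
  from det_unit_rows[of Inl, OF _ this] show ?thesis
    by (simp add: block_mat_def)
qed

lemma det_block_mat_lower:
  fixes D :: "'a::comm_ring_1 ^ 'k::finite ^ 'k" and C :: "'a ^ 'n::finite ^ 'k"
  shows "det (block_mat (mat 1) 0 C D) = det D"
proof -
  have "block_mat (mat 1) 0 C D $ i = axis i 1" if "i \<notin> range Inr" for i
    using that by (cases i) (auto simp: block_mat_def vec_eq_iff axis_def mat_def split: sum.splits)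
  from det_unit_rows[of Inr, OF _ this] show ?thesis
    by (simp add: block_mat_def)
qed

text \<open>Both sides are the determinant of the block matrix with rows \<open>(I, -X)\<close> and \<open>(Y, I)\<close>.\<close>

lemma det_Sylvester:
  fixes X :: "'a::comm_ring_1 ^ 'k::finite ^ 'n::finite" and Y :: "'a ^ 'n ^ 'k"
  shows "det (mat 1 + X ** Y) = det (mat 1 + Y ** X)"
proof -
  let ?K = "block_mat (mat 1) (- X) Y (mat 1)"
  have neg: "(- X) ** (- Y) = X ** Y"
    by (simp add: matrix_matrix_mult_def vec_eq_iff)
  \<comment> \<open>Both right factors are triangular with determinant 1: this one clears the block
    \<open>Y\<close>, the later one the block \<open>- X\<close>.\<close>
  have "?K ** block_mat (mat 1) 0 (- Y) (mat 1) = block_mat (mat 1 + X ** Y) (- X) 0 (mat 1)"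
    by (simp add: block_mat_mult neg)
  from arg_cong[OF this, of det] have "det ?K = det (mat 1 + X ** Y)"
    by (simp add: det_mul det_block_mat_upper det_block_mat_lower)
  moreover have "?K ** block_mat (mat 1) X 0 (mat 1) = block_mat (mat 1) 0 Y (mat 1 + Y ** X)"
    by (simp add: block_mat_mult add.commute)
  from arg_cong[OF this, of det] have "det ?K = det (mat 1 + Y ** X)"
    by (simp add: det_mul det_block_mat_upper det_block_mat_lower)
  ultimately show ?thesis by simp
qed

section \<open>Inverses and positive definite matrices\<close>

lemma matrix_inv_works:
  assumes "invertible A"
  shows "A ** matrix_inv A = mat 1" "matrix_inv A ** A = mat 1"
  using someI_ex[OF assms[unfolded invertible_def]] by (auto simp: matrix_inv_def)

lemma det_matrix_inv:
  fixes A :: "'a::field ^ 'n ^ 'n"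
  assumes "invertible A"
  shows "det (matrix_inv A) = inverse (det A)"
  using arg_cong[OF matrix_inv_works(1)[OF assms], of det]
  by (simp add: det_mul inverse_unique)

lemma matrix_inv_involution:
  fixes A :: "'a::field ^ 'n ^ 'n"
  assumes "invertible A"
  shows "matrix_inv (matrix_inv A) = A"
proof -
  have "invertible (matrix_inv A)"
    using matrix_inv_works[OF assms] unfolding invertible_def by blast
  from matrix_inv_works(1)[OF this] have "A ** (matrix_inv A ** matrix_inv (matrix_inv A)) = A"
    by simp
  then show ?thesis
    by (simp add: matrix_mul_assoc matrix_inv_works[OF assms])
qed

lemma det_scaleR:
  fixes A :: "real ^ 'n ^ 'n"
  shows "det (c *\<^sub>R A) = c ^ CARD('n) * det A"
proof -
  have "c *\<^sub>R A = (\<chi> i. c *s A $ i)"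
    by (simp add: vec_eq_iff)
  then show ?thesis
    by (simp add: det_rows_mul)
qed

lemma inner_transpose_matrix:
  fixes A :: "real ^ 'n ^ 'm"
  shows "x \<bullet> (A *v y) = (transpose A *v x) \<bullet> y"
  by (simp add: dot_lmul_matrix)

lemma SPD_invertible:
  assumes "A \<in> SPD"
  shows "invertible A"
proof -
  have "x = 0" if "A *v x = 0" for x
    using assms that by (force simp: SPD_def)
  then obtain B where "B ** A = mat 1"
    using matrix_left_invertible_ker[of A] by blast
  then show ?thesis
    by (auto simp: invertible_def matrix_left_right_inverse)
qed

lemma SPD_matrix_inv:
  assumes "A \<in> SPD"
  shows "matrix_inv A \<in> SPD"
proof -
  let ?B = "matrix_inv A"
  note inv = matrix_inv_works[OF SPD_invertible[OF assms]]
  have A: "transpose A = A" "\<And>z. z \<noteq> 0 \<Longrightarrow> z \<bullet> (A *v z) > 0"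
    using assms by (auto simp: SPD_def)
  \<comment> \<open>Transposing \<open>A ** ?B = mat 1\<close> makes \<open>transpose ?B\<close> a
    left inverse of \<open>A\<close>, which must equal the right inverse \<open>?B\<close>.\<close>
  have "transpose ?B ** A = mat 1"
    using arg_cong[OF inv(1), of transpose] by (simp add: matrix_transpose_mul A)
  then have "transpose ?B ** (A ** ?B) = ?B"
    by (simp add: matrix_mul_assoc)
  then have sym: "transpose ?B = ?B"
    by (simp add: inv)
  have "z \<bullet> (?B *v z) > 0" if "z \<noteq> 0" for z
  proof -
    \<comment> \<open>The form of \<open>?B\<close> at \<open>z\<close> is the form of
      \<open>A\<close> at \<open>?B *v z\<close>.\<close>
    have z: "A *v (?B *v z) = z"
      by (simp add: matrix_vector_mul_assoc inv)
    with that have "?B *v z \<noteq> 0" by auto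
    from A(2)[OF this] show ?thesis
      by (simp add: z inner_commute)
  qed
  with sym show ?thesis by (simp add: SPD_def)
qed

section \<open>The precision matrix: quadratic form, mean and determinant\<close>

text \<open>\<open>S\<close> and \<open>c\<close> stand for \<open>matrix_inv \<Sigma>\<close> and
  \<open>1 / \<sigma>\<^sup>2\<close>, so that no inverse enters the formula for the precision
  matrix.\<close>

locale stiefel_precision =
  fixes U :: "real ^ 'd ^ 'n" and S :: "real ^ 'd ^ 'd" and c :: real
  assumes U: "U \<in> Stiefel" and S: "S \<in> SPD" and c: "c > 0"
begin

definition precision :: "real ^ 'n ^ 'n" where
  "precision = c *\<^sub>R (mat 1 - U ** transpose U) + U ** S ** transpose U"

lemma UU: "transpose U ** U = mat 1"
  using U by (simp add: Stiefel_def)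

lemma transpose_precision: "transpose precision = precision"
proof -
  have "transpose S = S" using S by (simp add: SPD_def)
  moreover have "transpose (A + B) = transpose A + transpose B"
    "transpose (A - B) = transpose A - transpose B" for A B :: "real ^ 'n ^ 'n"
    by (simp_all add: transpose_def vec_eq_iff)
  ultimately show ?thesis
    by (simp add: precision_def transpose_scalar matrix_transpose_mul matrix_mul_assoc)
qed

lemma precision_mult_vec:
  "precision *v z = c *\<^sub>R (z - U *v (transpose U *v z)) + U *v (S *v (transpose U *v z))"
  by (simp add: precision_def matrix_vector_mult_add_rdistrib matrix_vector_mult_diff_rdistrib
      scaleR_matrix_vector_assoc[symmetric] matrix_vector_mul_assoc matrix_mul_assoc
      del: transpose_matrix_vector)

lemma transpose_U_U_vec: "transpose U *v (U *v x) = x"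
  by (simp add: matrix_vector_mul_assoc UU del: transpose_matrix_vector)

lemma precision_form:
  "z \<bullet> (precision *v z) = c * (norm ((mat 1 - U ** transpose U) *v z))\<^sup>2
    + (transpose U *v z) \<bullet> (S *v (transpose U *v z))"
proof -
  let ?w = "transpose U *v z"
  have inner_U: "x \<bullet> (U *v y) = (transpose U *v x) \<bullet> y" for x y
    by (rule inner_transpose_matrix)
  have "(mat 1 - U ** transpose U) *v z = z - U *v ?w"
    by (simp add: matrix_vector_mult_diff_rdistrib matrix_vector_mul_assoc
        del: transpose_matrix_vector)
  \<comment> \<open>Pythagoras: \<open>U *v ?w\<close> is the orthogonal projection of
    \<open>z\<close> to the range of \<open>U\<close>, and it has the same norm as
    \<open>?w\<close>.\<close>
  moreover have "(norm (z - U *v ?w))\<^sup>2 = z \<bullet> z - ?w \<bullet> ?w"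
    by (simp add: power2_norm_eq_inner inner_diff inner_U inner_commute[of "U *v ?w" z]
        transpose_U_U_vec matrix_vector_mult_diff_distrib del: transpose_matrix_vector)
  ultimately show ?thesis
    by (simp add: precision_mult_vec inner_add_right inner_diff_right inner_U
        del: transpose_matrix_vector)
qed

text \<open>The two terms of \<open>precision_form\<close> are nonnegative and cannot vanish
  together: if \<open>transpose U *v z = 0\<close>, the complementary projection fixes
  \<open>z\<close> and the first is positive; otherwise the second is.\<close>

lemma precision_SPD: "precision \<in> SPD"
proof -
  have "z \<bullet> (precision *v z) > 0" if z: "z \<noteq> 0" for z
  proof (cases "transpose U *v z = 0")
    case True
    then have "(mat 1 - U ** transpose U) *v z = z"
      by (simp add: matrix_vector_mult_diff_rdistrib matrix_vector_mul_assoc[symmetric]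
          del: transpose_matrix_vector)
    with True z c show ?thesis
      by (simp add: precision_form del: transpose_matrix_vector)
  next
    case False
    then have "(transpose U *v z) \<bullet> (S *v (transpose U *v z)) > 0"
      using S by (simp add: SPD_def del: transpose_matrix_vector)
    with c show ?thesis
      by (simp add: precision_form add_nonneg_pos del: transpose_matrix_vector)
  qed
  then show ?thesis by (simp add: SPD_def transpose_precision)
qed

lemma precision_mean: "matrix_inv precision *v (U *v (S *v \<mu>)) = U *v \<mu>"
proof -
  have "U *v (S *v \<mu>) = precision *v (U *v \<mu>)"
    by (simp add: precision_mult_vec transpose_U_U_vec del: transpose_matrix_vector)
  then have "matrix_inv precision *v (U *v (S *v \<mu>)) =
      (matrix_inv precision ** precision) *v (U *v \<mu>)"
    by (simp only: matrix_vector_mul_assoc matrix_mul_assoc)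
  then show ?thesis
    by (simp add: matrix_inv_works[OF SPD_invertible[OF precision_SPD]])
qed

text \<open>The matrix acts as \<open>c\<close> on the complement of the range of \<open>U\<close>
  and as \<open>S\<close> on that range. The factor \<open>c ^ CARD('d)\<close> on the left keeps
  natural subtraction out of the exponent.\<close>

lemma det_precision: "det precision * c ^ CARD('d) = c ^ CARD('n) * det S"
proof -
  \<comment> \<open>Chosen so that \<open>mat 1 + ?M\<close> is
    \<open>inverse c *\<^sub>R S\<close>, the matrix that remains once Sylvester's identity brings
    \<open>transpose U\<close> next to \<open>U\<close>.\<close>
  let ?M = "inverse c *\<^sub>R S - mat 1"
  have "precision = c *\<^sub>R (mat 1 + U ** (?M ** transpose U))"
    using c by (simp add: matrix_eq precision_mult_vec matrix_vector_mult_add_rdistrib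
        matrix_vector_mult_diff_rdistrib scaleR_matrix_vector_assoc[symmetric]
        matrix_vector_mul_assoc[symmetric] algebra_simps
        del: transpose_matrix_vector)
  moreover have "(?M ** transpose U) ** U = ?M"
    by (simp add: matrix_mul_assoc[symmetric] UU)
  ultimately have "det precision = c ^ CARD('n) * (inverse c ^ CARD('d) * det S)"
    by (simp add: det_scaleR det_Sylvester[of U])
  then show ?thesis
    using c by (simp add: field_simps)
qed

end

section \<open>Comparison of normalising constants and exponents\<close>

theorem lemma3p1:
  fixes \<sigma> :: real
    and \<mu> :: "real ^ 'd"
    and \<Sigma> :: "real ^ 'd ^ 'd"
    and U :: "real ^ 'd ^ 'n"
    and b :: "real ^ 'n"
  assumes "CARD('d) \<le> CARD('n)"
    and "\<sigma> > 0"
    and "\<Sigma> \<in> SPD"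
    and "U \<in> Stiefel"
  defines "P \<equiv> (1 / \<sigma>\<^sup>2) *\<^sub>R (mat 1 - U ** transpose U) + U ** matrix_inv \<Sigma> ** transpose U"
  defines "\<Sigma>' \<equiv> matrix_inv P"
  defines "\<mu>' \<equiv> \<Sigma>' *v (U *v (matrix_inv \<Sigma> *v \<mu>)) + b"
  shows "invertible P \<and> \<Sigma>' \<in> SPD \<and>
    (\<forall>x :: real ^ 'n.
       gaussian_density (transpose U *v (x - b)) \<mu> \<Sigma> *
         exp (- (1 / (2 * \<sigma>\<^sup>2)) * (norm ((mat 1 - U ** transpose U) *v (x - b)))\<^sup>2) =
       (2 * pi * \<sigma>\<^sup>2) powr ((real CARD('n) - real CARD('d)) / 2) * gaussian_density x \<mu>' \<Sigma>')"
proof -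
  interpret stiefel_precision U "matrix_inv \<Sigma>" "1 / \<sigma>\<^sup>2"
    using assms by unfold_locales (auto intro: SPD_matrix_inv)
  have P: "P = precision"
    by (simp add: P_def precision_def)
  note invP = SPD_invertible[OF precision_SPD]
  define s where "s = \<sigma>\<^sup>2"
  have s: "s > 0" using \<open>\<sigma> > 0\<close> by (simp add: s_def)
  have \<mu>': "\<mu>' = U *v \<mu> + b"
    by (simp add: \<mu>'_def \<Sigma>'_def P precision_mean)
  note inv\<Sigma> = SPD_invertible[OF \<open>\<Sigma> \<in> SPD\<close>]
  have nz: "det precision \<noteq> 0" "det \<Sigma> \<noteq> 0"
    using invP inv\<Sigma> by (simp_all add: invertible_det_nz)
  have dets: "det \<Sigma>' = inverse (det precision)" "det (matrix_inv \<Sigma>) = inverse (det \<Sigma>)"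
    by (simp_all only: \<Sigma>'_def P det_matrix_inv[OF invP] det_matrix_inv[OF inv\<Sigma>])
  \<comment> \<open>This is the reciprocal of \<open>det_precision\<close> at
    \<open>c = 1 / s\<close>.\<close>
  have "det \<Sigma>' * s ^ CARD('d) = s ^ CARD('n) * det \<Sigma>"
    using det_precision[folded s_def] nz[folded s_def] s
    by (simp add: dets[folded s_def] field_simps)
  from arg_cong[OF this, of "\<lambda>t. t powr (- 1 / 2)"]
  have det: "det \<Sigma>' powr (- 1 / 2) * s powr (- real CARD('d) / 2) =
      s powr (- real CARD('n) / 2) * det \<Sigma> powr (- 1 / 2)"
    using s by (simp add: powr_mult powr_realpow[symmetric] powr_powr)
  have const: "(2 * pi * s) powr ((real CARD('n) - real CARD('d)) / 2) *
      ((2 * pi) powr (- real CARD('n) / 2) * det \<Sigma>' powr (- 1 / 2)) =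
      (2 * pi) powr (- real CARD('d) / 2) * det \<Sigma> powr (- 1 / 2)" (is "?l = ?r")
  proof -
    have exps: "t powr ((real CARD('n) - real CARD('d)) / 2) =
        t powr (real CARD('n) / 2) * t powr (- real CARD('d) / 2)" for t :: real
      by (simp add: powr_add[symmetric] diff_divide_distrib)
    \<comment> \<open>Positivity matters, because \<open>0 powr 0 = 0\<close>.\<close>
    have cancel: "t powr (real CARD('n) / 2) * t powr (- real CARD('n) / 2) = 1"
      if "t > 0" for t :: real
      using that by (simp add: powr_add[symmetric])
    \<comment> \<open>Grouped so that the powers of \<open>2 * pi\<close> cancel first and
      \<open>det\<close> then supplies the power of \<open>s\<close> that cancels
      \<open>s powr (real CARD('n) / 2)\<close>.\<close>
    have "?l = ((2 * pi) powr (real CARD('n) / 2) * (2 * pi) powr (- real CARD('n) / 2)) *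
        (2 * pi) powr (- real CARD('d) / 2) * s powr (real CARD('n) / 2) *
        (det \<Sigma>' powr (- 1 / 2) * s powr (- real CARD('d) / 2))"
      unfolding powr_mult[of "2 * pi" s] exps by (simp only: mult_ac)
    also have "\<dots> = (s powr (real CARD('n) / 2) * s powr (- real CARD('n) / 2)) * ?r"
      unfolding det cancel[OF pi_gt_zero[THEN mult_pos_pos[OF zero_less_numeral]]]
      by (simp only: mult_ac mult_1)
    finally show ?thesis
      by (simp only: cancel[OF s] mult_1)
  qed
  have "gaussian_density (transpose U *v (x - b)) \<mu> \<Sigma> *
         exp (- (1 / (2 * \<sigma>\<^sup>2)) * (norm ((mat 1 - U ** transpose U) *v (x - b)))\<^sup>2) =
       (2 * pi * \<sigma>\<^sup>2) powr ((real CARD('n) - real CARD('d)) / 2) * gaussian_density x \<mu>' \<Sigma>'" for x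
  proof -
    let ?z = "x - b - U *v \<mu>" and ?w = "transpose U *v (x - b) - \<mu>"
    let ?N = "norm ((mat 1 - U ** transpose U) *v (x - b))"
    have "transpose U *v ?z = ?w"
      by (simp only: matrix_vector_mult_diff_distrib transpose_U_U_vec)
    \<comment> \<open>The shift by \<open>U *v \<mu>\<close> disappears, since this projection kills
      the range of \<open>U\<close>.\<close>
    moreover have "(mat 1 - U ** transpose U) *v ?z = (mat 1 - U ** transpose U) *v (x - b)"
      by (simp only: matrix_vector_mult_diff_distrib matrix_vector_mult_diff_rdistrib
          matrix_vector_mul_assoc[symmetric] transpose_U_U_vec matrix_vector_mul_lid)
         simp
    ultimately have form: "?z \<bullet> (precision *v ?z) = 1 / s * ?N\<^sup>2 + ?w \<bullet> (matrix_inv \<Sigma> *v ?w)"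
      by (simp only: precision_form s_def)
    have z: "x - \<mu>' = ?z" by (simp add: \<mu>')
    \<comment> \<open>The density inverts its covariance, which undoes the inverse in the definition
      of \<open>\<Sigma>'\<close>.\<close>
    have inv: "matrix_inv \<Sigma>' = precision"
      by (simp add: \<Sigma>'_def P matrix_inv_involution invP)
    have "exp (- (1 / 2) * (?z \<bullet> (precision *v ?z))) =
        exp (- (1 / 2) * (?w \<bullet> (matrix_inv \<Sigma> *v ?w))) * exp (- (1 / (2 * s)) * ?N\<^sup>2)"
      unfolding form exp_add[symmetric] by (simp add: algebra_simps)
    then show ?thesis
      unfolding gaussian_density_def z inv s_def[symmetric]
      by (simp only: mult.assoc[symmetric] const[unfolded mult.assoc[symmetric]])
  qed
  then show ?thesis
    using invP SPD_matrix_inv[OF precision_SPD] by (simp add: P \<Sigma>'_def)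
qed

end
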